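(* Let $r\ge 1$, $k\ge 1$, $n = rk+1$, and fix an $r$-perfect matching $M$ of $[rk]$. Then there is a bijection between the set of $(r+1)$-spanning trees $T$ on the vertex set $[n]$ with $\mu(T)=M$ (the $(r+1)$-spanning trees arising from $M$) and the set $\mathsf{Park}_k^r$ of $r$-parking functions of length $k$. In particular these two sets have the same cardinality.
   Context: For $s\ge 2$, an $s$-spanning tree on a vertex set $V$ is a set $E$ of $s$-element subsets of $V$ (hyperedges) such that the bipartite incidence graph (vertex classes $V$ and $E$, a hyperedge adjacent exactly to the vertices it contains) is a tree. An $r$-perfect matching of a set $W$ is a partition of $W$ into blocks of size $r$. For an $(r+1)$-spanning tree $T$ on $[rk+1]$, the $r$-perfect matching $\mu(T)$ of $[rk]$ it arises from is obtained as follows: delete vertex $n=rk+1$ from every hyperedge of $T$; each hyperedge that now has size $r$ becomes a block of $\mu(T)$, and its vertices are called matched. Then repeatedly delete all matched vertices from the remaining (not yet used) hyperedges of size $r+1$; each such hyperedge that drops to size $r$ becomes a block of $\mu(T)$ and its vertices become matched. This terminates with an $r$-perfect matching $\mu(T)$ of $[rk]$, having the property that each hyperedge of $T$ contains exactly one block of $\mu(T)$. A sequence $(a_1,\dots,a_k)\in\mathbb{Z}_{\ge 0}^k$ is an $r$-parking function of length $k$ if its weakly increasing rearrangement $b_1\le \dots\le b_k$ satisfies $b_i \le r(i-1)$ for all $i$; $\mathsf{Park}_k^r$ denotes the set of these. *)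

theory Defs
  imports "Graph_Theory.Graph_Theory" "HOL-Library.Disjoint_Sets"
begin

text \<open>
  Undirected graphs are represented as symmetric digraphs. The library's \<open>tree\<close> forbids every
  directed cycle, so no symmetric digraph with an edge satisfies it: traversing an edge back and
  forth is already a directed cycle of length 2. Cycles of an undirected simple graph are the
  directed cycles of length at least 3 of its symmetric digraph.
\<close>

definition incidence_graph :: "'a set \<Rightarrow> 'a set set \<Rightarrow> ('a + 'a set) pair_pre_digraph" where
  "incidence_graph V E =
     \<lparr> pverts = V <+> E,
       parcs = {(Inl v, Inr e) | v e. v \<in> V \<and> e \<in> E \<and> v \<in> e}
             \<union> {(Inr e, Inl v) | v e. v \<in> V \<and> e \<in> E \<and> v \<in> e} \<rparr>"

definition undirected_tree :: "'b pair_pre_digraph \<Rightarrow> bool" where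
  "undirected_tree G \<longleftrightarrow>
     pair_graph G \<and> Digraph_Component.connected (with_proj G) \<and>
     \<not> (\<exists>p. pre_digraph.cycle (with_proj G) p \<and> 3 \<le> length p)"

definition hyper_spanning_tree :: "nat \<Rightarrow> 'a set \<Rightarrow> 'a set set \<Rightarrow> bool" where
  "hyper_spanning_tree s V E \<longleftrightarrow>
     (\<forall>e\<in>E. e \<subseteq> V \<and> card e = s) \<and> undirected_tree (incidence_graph V E)"

definition perfect_matching :: "nat \<Rightarrow> 'a set \<Rightarrow> 'a set set \<Rightarrow> bool" where
  "perfect_matching r W M \<longleftrightarrow> partition_on W M \<and> (\<forall>B\<in>M. card B = r)"

text \<open>
  The state of the matching procedure is a pair of the blocks found so far and the remaining
  hyperedges. \<open>delete_round r X (B, H)\<close> deletes the vertices \<open>X\<close> from all remaining hyperedges;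
  those which then have size \<open>r\<close> become blocks, those which still have size \<open>r + 1\<close> remain.
\<close>

definition delete_round ::
  "nat \<Rightarrow> 'a set \<Rightarrow> 'a set set \<times> 'a set set \<Rightarrow> 'a set set \<times> 'a set set" where
  "delete_round r X = (\<lambda>(B, H).
     let H' = (\<lambda>e. e - X) ` H
     in (B \<union> {e \<in> H'. card e = r}, {e \<in> H'. card e = r + 1}))"

fun matching_state :: "nat \<Rightarrow> 'a \<Rightarrow> 'a set set \<Rightarrow> nat \<Rightarrow> 'a set set \<times> 'a set set" where
  "matching_state r n T 0 = delete_round r {n} ({}, T)"
| "matching_state r n T (Suc j) =
     (let S = matching_state r n T j in delete_round r (\<Union> (fst S)) S)"

text \<open>The set of blocks only grows, so the union over all rounds is the final set of blocks.\<close>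

definition arising_matching :: "nat \<Rightarrow> 'a \<Rightarrow> 'a set set \<Rightarrow> 'a set set" where
  "arising_matching r n T = (\<Union>j. fst (matching_state r n T j))"

text \<open>List positions start at 0, so \<open>sort a ! i\<close> is the entry \<open>b\<close> with index \<open>i + 1\<close>.\<close>

definition parking_functions :: "nat \<Rightarrow> nat \<Rightarrow> nat list set" where
  "parking_functions r k = {a. length a = k \<and> (\<forall>i<k. sort a ! i \<le> r * i)}"

end

(*
  A tree T arising from M is encoded by its parent map p: each hyperedge is a block B of M together
  with one further vertex p B, the vertex of that hyperedge closest to the root n. The maps p that
  occur are those for which every nonempty set S of blocks contains some B whose parent p B lies in
  {n} or in a block outside S; otherwise the blocks of S would never be reached from n. Parking
  functions f on M satisfy the same kind of condition: every nonempty S contains some B with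
  f B <= r * |M - S|. Both are of the form p B : W (M - S) for a monotone set function W with
  |W K| = 1 + r * |K|. The number of such p depends only on the cardinalities |W K|, as one sees by
  splitting off the first layer {B. p B : W {}} and recursing with W (L Un K) - W {}.
*)
theory Submission
  imports Defs "HOL-Library.FuncSet"
begin

section \<open>Admissible maps and how their number depends on the set function\<close>

definition admissible :: "('a set \<Rightarrow> 'b set) \<Rightarrow> 'a set \<Rightarrow> ('a \<Rightarrow> 'b) set" where
  "admissible W M =
     {p \<in> M \<rightarrow>\<^sub>E W M. \<forall>S\<subseteq>M. S \<noteq> {} \<longrightarrow> (\<exists>B\<in>S. p B \<in> W (M - S))}"

text \<open>Membership of the values in \<open>W M\<close> is automatic: the condition for
  \<open>S = {B}\<close> puts \<open>p B\<close> into \<open>W (M - {B})\<close>, which monotonicity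
  places inside \<open>W M\<close>.\<close>

lemma admissibleI:
  assumes "mono_on (Pow M) W" "p \<in> extensional M"
    and "\<And>S. S \<subseteq> M \<Longrightarrow> S \<noteq> {} \<Longrightarrow> \<exists>B\<in>S. p B \<in> W (M - S)"
  shows "p \<in> admissible W M"
proof -
  have "p B \<in> W M" if "B \<in> M" for B
    using assms(3)[of "{B}"] monotone_onD[OF assms(1), of "M - {B}" M] that by auto
  with assms(2,3) show ?thesis
    by (auto simp: admissible_def PiE_iff)
qed

lemma admissibleD:
  assumes "p \<in> admissible W M"
  shows "p \<in> extensional M"
    and "\<And>S. S \<subseteq> M \<Longrightarrow> S \<noteq> {} \<Longrightarrow> \<exists>B\<in>S. p B \<in> W (M - S)"
proof -
  have *: "p \<in> M \<rightarrow>\<^sub>E W M" "\<forall>S\<subseteq>M. S \<noteq> {} \<longrightarrow> (\<exists>B\<in>S. p B \<in> W (M - S))"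
    using assms unfolding admissible_def mem_Collect_eq by simp_all
  show "p \<in> extensional M" using *(1) by (simp add: PiE_def)
  show "\<exists>B\<in>S. p B \<in> W (M - S)" if "S \<subseteq> M" "S \<noteq> {}" for S
    using *(2) that by simp
qed

lemma finite_admissible:
  assumes "finite M" "finite (W M)"
  shows "finite (admissible W M)"
  using finite_PiE[of M "\<lambda>_. W M"] assms by (auto simp: admissible_def)

text \<open>A map with first layer \<open>L\<close> splits into an arbitrary map from
  \<open>L\<close> to \<open>W {}\<close> and an admissible map on \<open>M - L\<close>. A set
  \<open>S\<close> disjoint from \<open>L\<close> has complement
  \<open>L \<union> (M - L - S)\<close>, and values outside the first layer avoid
  \<open>W {}\<close>; hence the residual set function is shifted by \<open>L\<close> and loses
  \<open>W {}\<close>.\<close>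

lemma card_admissible_layer:
  assumes "finite M" "finite (W M)" "mono_on (Pow M) W" "L \<subseteq> M"
  shows "card {p \<in> admissible W M. {B \<in> M. p B \<in> W {}} = L} =
         card (W {}) ^ card L * card (admissible (\<lambda>K. W (L \<union> K) - W {}) (M - L))"
    (is "card ?A = _ * card ?V")
proof -
  let ?W' = "\<lambda>K. W (L \<union> K) - W {}"
  let ?f = "\<lambda>p. (restrict p L, restrict p (M - L))"
  let ?g = "\<lambda>(q, q') B. if B \<in> L then q B else q' B"
  have mono: "W X \<subseteq> W Y" if "X \<subseteq> Y" "Y \<subseteq> M" for X Y
    using monotone_onD[OF assms(3), of X Y] that by auto
  have mono': "mono_on (Pow (M - L)) ?W'"
    using assms(4) by (intro monotone_onI Diff_mono mono) auto
  have "bij_betw ?f ?A ((L \<rightarrow>\<^sub>E W {}) \<times> ?V)"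
  proof (rule bij_betw_byWitness[where f' = ?g])
    show "\<forall>p\<in>?A. ?g (?f p) = p"
    proof
      fix p assume "p \<in> ?A"
      then have "p \<in> admissible W M" by simp
      then have "p \<in> extensional M" by (rule admissibleD(1))
      then show "?g (?f p) = p"
        using assms(4) by (auto simp: fun_eq_iff extensional_def)
    qed
    show "\<forall>q\<in>(L \<rightarrow>\<^sub>E W {}) \<times> ?V. ?f (?g q) = q"
    proof
      fix z assume "z \<in> (L \<rightarrow>\<^sub>E W {}) \<times> ?V"
      then obtain q q' where z: "z = (q, q')" and "q \<in> L \<rightarrow>\<^sub>E W {}" "q' \<in> ?V"
        by (rule SigmaE)
      then have "q \<in> extensional L" "q' \<in> extensional (M - L)"
        using admissibleD(1)[of q' ?W'] by (simp_all add: PiE_def)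
      then show "?f (?g z) = z"
        by (simp add: z fun_eq_iff extensional_def restrict_def)
    qed
    show "?f ` ?A \<subseteq> (L \<rightarrow>\<^sub>E W {}) \<times> ?V"
    proof (rule image_subsetI)
      fix p assume "p \<in> ?A"
      then have p: "p \<in> admissible W M" and L: "{B \<in> M. p B \<in> W {}} = L"
        by simp_all
      have "restrict p (M - L) \<in> ?V"
      proof (rule admissibleI[OF mono'])
        fix S assume S: "S \<subseteq> M - L" "S \<noteq> {}"
        then obtain B where B: "B \<in> S" "p B \<in> W (M - S)"
          using admissibleD(2)[OF p, of S] assms(4) by blast
        have "M - S = L \<union> (M - L - S)" using S assms(4) by auto
        then show "\<exists>B\<in>S. restrict p (M - L) B \<in> ?W' (M - L - S)"
          using B S L by auto
      qed simp
      moreover have "restrict p L \<in> L \<rightarrow>\<^sub>E W {}"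
        using L by auto
      ultimately show "?f p \<in> (L \<rightarrow>\<^sub>E W {}) \<times> ?V"
        by simp
    qed
    show "?g ` ((L \<rightarrow>\<^sub>E W {}) \<times> ?V) \<subseteq> ?A"
    proof (rule image_subsetI)
      fix z assume "z \<in> (L \<rightarrow>\<^sub>E W {}) \<times> ?V"
      then obtain q q' where z: "z = (q, q')" and q: "q \<in> L \<rightarrow>\<^sub>E W {}" and q': "q' \<in> ?V"
        by (rule SigmaE)
      define p where p: "p = ?g (q, q')"
      have "p \<in> admissible W M"
      proof (rule admissibleI[OF assms(3)])
        show "p \<in> extensional M"
          using p admissibleD(1)[OF q'] assms(4) by (auto simp: extensional_def)
      next
        fix S assume S: "S \<subseteq> M" "S \<noteq> {}"
        show "\<exists>B\<in>S. p B \<in> W (M - S)"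
        \<comment> \<open>If \<open>S\<close> meets \<open>L\<close>, any common element works,
          because its value lies in \<open>W {}\<close>. Otherwise the condition on
          \<open>q'\<close> applies to \<open>S\<close>.\<close>
        proof (cases "S \<inter> L = {}")
          case True
          then have "S \<subseteq> M - L" using S by auto
          then obtain B where B: "B \<in> S" "q' B \<in> ?W' (M - L - S)"
            using admissibleD(2)[OF q', of S] S by blast
          moreover have "L \<union> (M - L - S) = M - S" using True assms(4) by auto
          ultimately show ?thesis using True p by (auto intro!: bexI[of _ B])
        next
          case False
          then obtain B where "B \<in> S" "B \<in> L" by auto
          then show ?thesis using p q mono[of "{}" "M - S"] by (auto intro!: bexI[of _ B])
        qed
      qed
      moreover have "{B \<in> M. p B \<in> W {}} = L"
      proof -
        \<comment> \<open>Subtracting \<open>W {}\<close> in \<open>?W'\<close> keeps the values of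
          \<open>q'\<close> out of \<open>W {}\<close>, so the first layer of the glued map does not
          grow beyond \<open>L\<close>.\<close>
        have "p B \<in> W {} \<longleftrightarrow> B \<in> L" if "B \<in> M" for B
        proof (cases "B \<in> L")
          case True
          then show ?thesis using p q by auto
        next
          case False
          then have "q' B \<in> ?W' (M - L)"
            using q' that by (auto simp: admissible_def)
          then show ?thesis using p False by simp
        qed
        then show ?thesis using assms(4) by auto
      qed
      ultimately show "?g z \<in> ?A" unfolding p z by simp
    qed
  qed
  moreover have "finite L" using assms finite_subset by auto
  ultimately show ?thesis
    by (simp add: bij_betw_same_card card_cartesian_product card_PiE)
qed

text \<open>Maps are sorted by their first layer. The empty layer cannot occur: the condition for
  \<open>S = M\<close> produces an element with value in \<open>W {}\<close>.\<close>

lemma card_admissible_rec: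
  assumes "finite M" "M \<noteq> {}" "finite (W M)" "mono_on (Pow M) W"
  shows "card (admissible W M) =
    (\<Sum>L\<in>Pow M - {{}}. card (W {}) ^ card L * card (admissible (\<lambda>K. W (L \<union> K) - W {}) (M - L)))"
proof -
  let ?A = "\<lambda>L. {p \<in> admissible W M. {B \<in> M. p B \<in> W {}} = L}"
  have "{B \<in> M. p B \<in> W {}} \<noteq> {}" if "p \<in> admissible W M" for p
    using admissibleD(2)[OF that, of M] assms(2) by auto
  then have "admissible W M = (\<Union>L\<in>Pow M - {{}}. ?A L)" by auto
  then have "card (admissible W M) = card (\<Union>L\<in>Pow M - {{}}. ?A L)" by simp
  also have "\<dots> = (\<Sum>L\<in>Pow M - {{}}. card (?A L))"
    using assms finite_admissible[of M W] by (intro card_UN_disjoint) auto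
  also have "\<dots> = (\<Sum>L\<in>Pow M - {{}}.
      card (W {}) ^ card L * card (admissible (\<lambda>K. W (L \<union> K) - W {}) (M - L)))"
    using assms by (intro sum.cong refl card_admissible_layer) auto
  finally show ?thesis .
qed

text \<open>Induction on \<open>card M\<close> through the first-layer recursion. Each summand
  involves only \<open>card (W {})\<close> and the count for a residual function, whose
  cardinalities are the differences \<open>card (W (L \<union> K)) - card (W {})\<close>. A nonempty
  \<open>L\<close> makes \<open>M - L\<close> smaller.\<close>

lemma card_admissible_cong:
  fixes W :: "'a set \<Rightarrow> 'b set" and W' :: "'a set \<Rightarrow> 'c set"
  assumes "finite M" "finite (W M)" "finite (W' M)"
    and "mono_on (Pow M) W" "mono_on (Pow M) W'"
    and "\<And>K. K \<subseteq> M \<Longrightarrow> card (W K) = card (W' K)"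
  shows "card (admissible W M) = card (admissible W' M)"
  using assms
proof (induction "card M" arbitrary: M W W' rule: less_induct)
  case less
  show ?case
  proof (cases "M = {}")
    case True
    then show ?thesis by (simp add: admissible_def)
  next
    case False
    have mono: "W X \<subseteq> W Y" "W' X \<subseteq> W' Y" if "X \<subseteq> Y" "Y \<subseteq> M" for X Y
      using monotone_onD[OF less.prems(4), of X Y] monotone_onD[OF less.prems(5), of X Y] that
      by auto
    have fin: "finite (W K)" "finite (W' K)" if "K \<subseteq> M" for K
      using that less.prems(2,3) mono[of K M] finite_subset by blast+
    have IH: "card (admissible (\<lambda>K. W (L \<union> K) - W {}) (M - L)) =
              card (admissible (\<lambda>K. W' (L \<union> K) - W' {}) (M - L))" if L: "L \<in> Pow M - {{}}" for L
    proof (rule less.hyps)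
      have "M - L \<subset> M" using L by auto
      then show "card (M - L) < card M" using less.prems(1) psubset_card_mono by blast
      show "finite (M - L)" using less.prems(1) by simp
      have "L \<union> (M - L) = M" using L by auto
      then show "finite (W (L \<union> (M - L)) - W {})" "finite (W' (L \<union> (M - L)) - W' {})"
        using less.prems by auto
      have *: "L \<union> X \<subseteq> L \<union> Y" "L \<union> Y \<subseteq> M" if "X \<subseteq> Y" "Y \<subseteq> M - L" for X Y
        using that L by auto
      show "mono_on (Pow (M - L)) (\<lambda>K. W (L \<union> K) - W {})"
        by (intro monotone_onI Diff_mono mono *) auto
      show "mono_on (Pow (M - L)) (\<lambda>K. W' (L \<union> K) - W' {})"
        by (intro monotone_onI Diff_mono mono *) auto
      fix K assume K: "K \<subseteq> M - L"
      then have "L \<union> K \<subseteq> M" using L by auto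
      then show "card (W (L \<union> K) - W {}) = card (W' (L \<union> K) - W' {})"
        using mono[of "{}" "L \<union> K"] fin[of "{}"] less.prems(6)
        by (simp add: card_Diff_subset)
    qed
    show ?thesis
      using less.prems False IH by (simp add: card_admissible_rec)
  qed
qed

section \<open>Parking functions as admissible maps\<close>

lemma sort_nth_le_iff:
  fixes a :: "'a::linorder list"
  assumes "i < length a"
  shows "sort a ! i \<le> t \<longleftrightarrow> i < length (filter (\<lambda>y. y \<le> t) a)"
proof -
  let ?b = "sort a"
  \<comment> \<open>Sorting preserves the number of entries that are at most \<open>t\<close>. In
    the sorted list they occupy an initial segment of positions, so this number decides whether
    position \<open>i\<close> belongs to it.\<close>
  have len: "length (filter (\<lambda>y. y \<le> t) a) = card {j. j < length a \<and> ?b ! j \<le> t}"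
  proof -
    have "length (filter (\<lambda>y. y \<le> t) a) = length (filter (\<lambda>y. y \<le> t) ?b)"
      by (metis filter_sort length_sort)
    then show ?thesis by (simp add: length_filter_conv_card)
  qed
  show ?thesis
  proof
    assume "?b ! i \<le> t"
    then have "{..i} \<subseteq> {j. j < length a \<and> ?b ! j \<le> t}"
      using assms sorted_nth_mono[OF sorted_sort, of _ i a] by (auto intro: order_trans)
    then have "card {..i} \<le> card {j. j < length a \<and> ?b ! j \<le> t}"
      by (intro card_mono) auto
    then show "i < length (filter (\<lambda>y. y \<le> t) a)" using len by simp
  next
    assume *: "i < length (filter (\<lambda>y. y \<le> t) a)"
    show "?b ! i \<le> t"
    proof (rule ccontr)
      assume i: "\<not> ?b ! i \<le> t"
      have "j < i" if "j < length a" "?b ! j \<le> t" for j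
        using sorted_nth_mono[OF sorted_sort, of i j a] that i by force
      then have "{j. j < length a \<and> ?b ! j \<le> t} \<subseteq> {..<i}" by auto
      then have "card {j. j < length a \<and> ?b ! j \<le> t} \<le> card {..<i}"
        by (intro card_mono) auto
      then show False using * len by simp
    qed
  qed
qed

text \<open>The parking condition says that for every \<open>i < card M\<close> more than
  \<open>i\<close> elements have value at most \<open>r * i\<close>. With
  \<open>i = card (M - S)\<close> these elements are too many to fit into \<open>M - S\<close>, so
  one lies in \<open>S\<close>. Conversely, if at most \<open>i\<close> elements have value at most
  \<open>r * i\<close>, then the set \<open>S\<close> of all other elements violates
  admissibility.\<close>

lemma map_mem_parking_functions_iff:
  assumes "distinct xs" "set xs = M" "f \<in> extensional M"
  shows "map f xs \<in> parking_functions r (card M) \<longleftrightarrow>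
         f \<in> admissible (\<lambda>K. {..r * card K}) M"
proof -
  have fin: "finite M" and len: "length xs = card M"
    using assms by (auto simp: distinct_card)
  have "length (filter (\<lambda>y. y \<le> t) (map f xs)) = card {B \<in> M. f B \<le> t}" for t
    using assms(1,2) by (simp add: filter_map o_def distinct_length_filter Int_def conj_commute)
  then have park: "map f xs \<in> parking_functions r (card M) \<longleftrightarrow>
      (\<forall>i<card M. i < card {B \<in> M. f B \<le> r * i})"
    using len by (simp add: parking_functions_def sort_nth_le_iff)
  show ?thesis
  proof
    assume *: "map f xs \<in> parking_functions r (card M)"
    show "f \<in> admissible (\<lambda>K. {..r * card K}) M"
    proof (rule admissibleI)
      show "mono_on (Pow M) (\<lambda>K. {..r * card K})"
        using fin finite_subset by (intro monotone_onI) (auto intro!: mult_le_mono2 card_mono)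
      fix S assume S: "S \<subseteq> M" "S \<noteq> {}"
      have "finite S" using S fin finite_subset by auto
      then have card: "card (M - S) + card S = card M" "card S > 0"
        using S fin by (auto simp: card_Diff_subset card_mono card_gt_0_iff)
      then have "card (M - S) < card {B \<in> M. f B \<le> r * card (M - S)}"
        using * park by auto
      then have "\<not> {B \<in> M. f B \<le> r * card (M - S)} \<subseteq> M - S"
        using fin card_mono[of "M - S"] by (metis finite_Diff not_le)
      then show "\<exists>B\<in>S. f B \<in> {..r * card (M - S)}" by auto
    qed (fact assms(3))
  next
    assume *: "f \<in> admissible (\<lambda>K. {..r * card K}) M"
    have "i < card {B \<in> M. f B \<le> r * i}" if i: "i < card M" for i
    proof (rule ccontr)
      define C where "C = {B \<in> M. f B \<le> r * i}"
      assume "\<not> i < card {B \<in> M. f B \<le> r * i}"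
      then have n: "\<not> i < card C" by (simp add: C_def)
      then have "C \<noteq> M" using i by auto
      then have "M - C \<noteq> {}" unfolding C_def by blast
      then have "\<exists>B\<in>M - C. f B \<in> {..r * card (M - (M - C))}"
        by (intro admissibleD(2)[OF *] Diff_subset)
      then obtain B where B: "B \<in> M - C" "f B \<in> {..r * card (M - (M - C))}" ..
      have "M - (M - C) = C" by (auto simp: C_def)
      then have "f B \<le> r * card C" using B(2) by simp
      also have "\<dots> \<le> r * i" using n by simp
      finally show False using B(1) by (simp add: C_def)
    qed
    then show "map f xs \<in> parking_functions r (card M)"
      using park by simp
  qed
qed

lemma card_parking_functions:
  assumes "finite M"
  shows "finite (parking_functions r (card M))"
    and "card (parking_functions r (card M)) = card (admissible (\<lambda>K. {..r * card K}) M)"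
proof -
  obtain xs where xs: "distinct xs" "set xs = M"
    using finite_distinct_list[OF assms] by blast
  let ?V = "admissible (\<lambda>K. {..r * card K}) M"
  have V: "f \<in> extensional M" if "f \<in> ?V" for f
    using admissibleD(1)[OF that] .
  have "bij_betw (\<lambda>f. map f xs) ?V (parking_functions r (card M))"
    unfolding bij_betw_def
  proof
    show "inj_on (\<lambda>f. map f xs) ?V"
      by (rule inj_onI) (use V xs in \<open>auto intro: extensionalityI\<close>)
    have "a \<in> (\<lambda>f. map f xs) ` ?V" if a: "a \<in> parking_functions r (card M)" for a
    proof -
      have "length a = length xs"
        using a xs by (auto simp: parking_functions_def distinct_card)
      \<comment> \<open>The preimage of \<open>a\<close> reads the list as a function on
        \<open>M\<close>, sending each element of \<open>xs\<close> to the entry of \<open>a\<close>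
        at the same position.\<close>
      then have eq: "map (restrict (the \<circ> map_of (zip xs a)) M) xs = a"
        using xs by (intro nth_equalityI) (auto simp: map_of_zip_nth)
      then have "restrict (the \<circ> map_of (zip xs a)) M \<in> ?V"
        using map_mem_parking_functions_iff[OF xs, of "restrict (the \<circ> map_of (zip xs a)) M" r] a
        by simp
      with eq show ?thesis by (metis imageI)
    qed
    then show "(\<lambda>f. map f xs) ` ?V = parking_functions r (card M)"
      using map_mem_parking_functions_iff[OF xs V] by auto
  qed
  moreover have "finite ?V" using assms by (intro finite_admissible) auto
  ultimately show "finite (parking_functions r (card M))"
    "card (parking_functions r (card M)) = card ?V"
    by (auto simp: bij_betw_finite bij_betw_same_card)
qed

section \<open>Incidence graphs: connectedness, cycles and minimality of trees\<close>

lemma parcs_incidence_graph_iff: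
  "(x, y) \<in> parcs (incidence_graph V E) \<longleftrightarrow>
     (\<exists>v\<in>V. \<exists>e\<in>E. v \<in> e \<and> (x = Inl v \<and> y = Inr e \<or> x = Inr e \<and> y = Inl v))"
  by (auto simp: incidence_graph_def)

lemma pverts_incidence_graph [simp]: "pverts (incidence_graph V E) = V <+> E"
  by (simp add: incidence_graph_def)

lemma pair_graph_incidence_graph:
  assumes "finite V" "finite E"
  shows "pair_graph (incidence_graph V E)"
proof
  fix a assume "a \<in> parcs (incidence_graph V E)"
  then show "fst a \<in> pverts (incidence_graph V E)" "snd a \<in> pverts (incidence_graph V E)"
    "fst a \<noteq> snd a"
    by (cases a; auto simp: parcs_incidence_graph_iff)+
next
  show "finite (pverts (incidence_graph V E))" using assms by simp
  have "parcs (incidence_graph V E) \<subseteq> (V <+> E) \<times> (V <+> E)"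
    by (auto simp: incidence_graph_def)
  then show "finite (parcs (incidence_graph V E))"
    using assms by (meson finite_Plus finite_SigmaI finite_subset)
  show "symmetric (with_proj (incidence_graph V E))"
    by (auto simp: symmetric_def sym_def parcs_incidence_graph_iff)
qed

lemma (in pair_graph) connectedI_root:
  assumes "x \<in> pverts G" and "\<And>y. y \<in> pverts G \<Longrightarrow> x \<rightarrow>\<^sup>*\<^bsub>with_proj G\<^esub> y"
  shows "Digraph_Component.connected (with_proj G)"
  unfolding Digraph_Component.connected_def
proof (rule strongly_connectedI)
  show "verts (with_proj (mk_symmetric (with_proj G))) \<noteq> {}"
    using assms(1) by auto
  fix u v
  assume "u \<in> verts (with_proj (mk_symmetric (with_proj G)))"
    and "v \<in> verts (with_proj (mk_symmetric (with_proj G)))"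
  then have "u \<in> pverts G" "v \<in> pverts G" by auto
  then have "u \<rightarrow>\<^sup>*\<^bsub>with_proj G\<^esub> v"
    using assms(2) symmetric_reachable[OF sym_arcs] reachable_trans by blast
  then show "u \<rightarrow>\<^sup>*\<^bsub>with_proj (mk_symmetric (with_proj G))\<^esub> v"
    by (rule reachable_mk_symmetricI)
qed

lemma (in pair_graph) connectedD_reachable:
  assumes "Digraph_Component.connected (with_proj G)" "u \<in> pverts G" "v \<in> pverts G"
  shows "u \<rightarrow>\<^sup>*\<^bsub>with_proj G\<^esub> v"
proof -
  have "u \<rightarrow>\<^sup>*\<^bsub>with_proj (mk_symmetric (with_proj G))\<^esub> v"
    using assms unfolding Digraph_Component.connected_def strongly_connected_def by simp
  then show ?thesis
    by (subst (asm) reachable_mk_symmetric_eq[OF sym_arcs])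
qed

lemma pcas_nth:
  assumes "pcas u p v" "Suc i < length p"
  shows "snd (p ! i) = fst (p ! Suc i)"
  using assms
proof (induction p arbitrary: u i)
  case (Cons a p)
  show ?case
  proof (cases i)
    case 0
    with Cons.prems show ?thesis by (cases p) auto
  next
    case (Suc j)
    with Cons show ?thesis by auto
  qed
qed simp

lemma pcas_ends:
  assumes "pcas u p v" "p \<noteq> []"
  shows "fst (p ! 0) = u" "snd (p ! (length p - 1)) = v"
proof -
  show "fst (p ! 0) = u" using assms by (cases p) auto
  show "snd (p ! (length p - 1)) = v"
    using assms by (induction u p v rule: pcas.induct) (auto simp: nth_Cons' split: if_splits)
qed

lemma pcas_append: "pcas u (p @ q) w \<longleftrightarrow> (\<exists>v. pcas u p v \<and> pcas v q w)"
  by (induction p arbitrary: u) auto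

lemma pawalk_verts_conv:
  assumes "pcas u p v"
  shows "pawalk_verts u p = u # map snd p"
  using assms by (induction p arbitrary: u) auto

text \<open>The neighbours are the successor and the predecessor of \<open>w\<close> on the cycle.
  They differ because the cycle has at least three arcs and no repeated vertex.\<close>

lemma (in pair_sym_digraph) cycle_two_neighbours:
  assumes "cycle p" "3 \<le> length p" "w \<in> snd ` set p"
  shows "\<exists>x y. x \<in> snd ` set p \<and> y \<in> snd ` set p \<and> x \<noteq> y \<and>
    (w, x) \<in> parcs G \<and> (w, y) \<in> parcs G"
proof -
  let ?l = "length p"
  from assms(1) obtain u where cas: "pcas u p u" and arcs: "set p \<subseteq> parcs G"
    and dist: "distinct (map snd p)"
    unfolding cycle_def awalk_def by (auto simp: pawalk_verts_conv)
  from assms(3) obtain i where i: "i < ?l" "w = snd (p ! i)"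
    by (auto simp: in_set_conv_nth)
  have ne: "p \<noteq> []" using assms(2) by auto
  \<comment> \<open>Arc \<open>i\<close> ends in \<open>w\<close>. Cyclically, \<open>j\<close> is
    the next arc, which ends in the successor of \<open>w\<close>, and \<open>h\<close> is the
    previous arc, which ends in the predecessor.\<close>
  define j where "j = (if Suc i < ?l then Suc i else 0)"
  define h where "h = (if i = 0 then ?l - 1 else i - 1)"
  have jh: "j < ?l" "h < ?l" "j \<noteq> h"
    using i assms(2) by (auto simp: j_def h_def)
  have "fst (p ! j) = w"
    using i pcas_nth[OF cas, of i] pcas_ends[OF cas ne]
    by (cases "Suc i < ?l") (auto simp: j_def not_less_eq less_Suc_eq dest: Suc_lessI)
  moreover have "snd (p ! h) = fst (p ! i)"
    using i pcas_nth[OF cas, of "i - 1"] pcas_ends[OF cas ne] by (auto simp: h_def)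
  moreover have "p ! i \<in> parcs G" "p ! j \<in> parcs G"
    using arcs i jh by auto
  ultimately have "(w, snd (p ! j)) \<in> parcs G" "(w, snd (p ! h)) \<in> parcs G"
    using i arcs_symmetric by (metis prod.collapse)+
  moreover have "snd (p ! j) \<noteq> snd (p ! h)"
    using dist jh by (metis length_map nth_eq_iff_index_eq nth_map)
  ultimately show ?thesis
    using jh by (meson image_eqI nth_mem)
qed

text \<open>The incidence graph is bipartite, so both cycle neighbours of a node belong to the
  opposite class.\<close>

lemma cycle_incidence_graph:
  assumes "pair_graph (incidence_graph V E)"
    and "pre_digraph.cycle (with_proj (incidence_graph V E)) p" "3 \<le> length p"
    and C: "C = snd ` set p"
  shows "Inr e \<in> C \<Longrightarrow> \<exists>v w. v \<noteq> w \<and> v \<in> e \<and> w \<in> e \<and> Inl v \<in> C \<and> Inl w \<in> C"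
    and "Inl v \<in> C \<Longrightarrow>
      \<exists>e e'. e \<noteq> e' \<and> e \<in> E \<and> e' \<in> E \<and> v \<in> e \<and> v \<in> e' \<and> Inr e \<in> C \<and> Inr e' \<in> C"
proof -
  interpret pair_graph "incidence_graph V E" by fact
  note nbs = cycle_two_neighbours[OF assms(2,3), folded C]
  show "\<exists>v w. v \<noteq> w \<and> v \<in> e \<and> w \<in> e \<and> Inl v \<in> C \<and> Inl w \<in> C"
    if e: "Inr e \<in> C"
  proof -
    obtain x y where "x \<in> C" "y \<in> C" "x \<noteq> y"
      and "(Inr e, x) \<in> parcs (incidence_graph V E)" "(Inr e, y) \<in> parcs (incidence_graph V E)"
      using nbs[OF e] by blast
    then show ?thesis
      by (cases x; cases y) (auto simp: parcs_incidence_graph_iff)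
  qed
  show "\<exists>e e'. e \<noteq> e' \<and> e \<in> E \<and> e' \<in> E \<and> v \<in> e \<and> v \<in> e' \<and> Inr e \<in> C \<and> Inr e' \<in> C"
    if v: "Inl v \<in> C"
  proof -
    obtain x y where "x \<in> C" "y \<in> C" "x \<noteq> y"
      and "(Inl v, x) \<in> parcs (incidence_graph V E)" "(Inl v, y) \<in> parcs (incidence_graph V E)"
      using nbs[OF v] by blast
    then show ?thesis
      by (cases x; cases y) (auto simp: parcs_incidence_graph_iff)
  qed
qed

text \<open>If \<open>e\<close> were missing from \<open>E'\<close>, two of its vertices would still
  be joined by a path through \<open>E'\<close>. Closing this path through the node of
  \<open>e\<close> gives a cycle in the tree.\<close>

lemma undirected_tree_minimal:
  assumes "undirected_tree (incidence_graph V E)"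
    and "Digraph_Component.connected (with_proj (incidence_graph V E'))"
    and "E' \<subseteq> E" "e \<in> E" "e \<subseteq> V" "2 \<le> card e"
  shows "e \<in> E'"
proof (rule ccontr)
  assume e: "e \<notin> E'"
  let ?G = "incidence_graph V E" and ?H = "incidence_graph V E'"
  interpret G: pair_graph ?G
    using assms(1) by (simp add: undirected_tree_def)
  have "finite (V <+> E)" using G.pair_finite_verts by simp
  then have "finite V" "finite E'"
    using assms(3) by (auto simp: finite_Plus_iff intro: finite_subset)
  then interpret H: pair_graph ?H by (rule pair_graph_incidence_graph)
  have "\<not> is_singleton e" "e \<noteq> {}"
    using assms(6) by (auto simp: is_singleton_altdef)
  then obtain u v where uv: "u \<in> e" "v \<in> e" "u \<noteq> v"
    by (metis is_singletonI' ex_in_conv)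
  then have "Inl u \<rightarrow>\<^sup>*\<^bsub>with_proj ?H\<^esub> Inl v"
    using assms(5) by (intro H.connectedD_reachable[OF assms(2)]) auto
  then obtain q where q: "H.apath (Inl u) q (Inl v)"
    using H.reachable_apath by blast
  have cas: "pcas (Inl u) q (Inl v)" and arcs: "set q \<subseteq> parcs ?H"
    using q by (simp_all add: H.apath_def H.awalk_def)
  have dist: "distinct (Inl u # map snd q)"
    using q unfolding H.apath_def pawalk_verts_conv[OF cas] by (rule conjunct2)
  let ?p = "q @ [(Inl v, Inr e), (Inr e, Inl u)]"
  have "q \<noteq> []" using cas uv by auto
  have "parcs ?H \<subseteq> parcs ?G"
    using assms(3) by (auto simp: incidence_graph_def)
  moreover have "(Inl v, Inr e) \<in> parcs ?G" "(Inr e, Inl u) \<in> parcs ?G"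
    using uv assms(4,5) by (auto simp: parcs_incidence_graph_iff)
  ultimately have "set ?p \<subseteq> parcs ?G" using arcs by auto
  moreover have cas': "pcas (Inl u) ?p (Inl u)"
    unfolding pcas_append using cas by (intro exI[of _ "Inl v"]) simp
  moreover have "distinct (tl (pawalk_verts (Inl u) ?p))"
  proof -
    have "Inr e \<notin> snd ` set q"
      using arcs e by (auto simp: incidence_graph_def)
    then show ?thesis using dist by (simp add: pawalk_verts_conv[OF cas'])
  qed
  moreover have "Inl u \<in> V <+> E" using uv assms(5) by auto
  ultimately have "G.cycle ?p"
    unfolding G.cycle_def G.awalk_def pverts_incidence_graph by blast
  moreover have "3 \<le> length ?p" using \<open>q \<noteq> []\<close> by (cases q) auto
  ultimately show False
    using assms(1) unfolding undirected_tree_def by blast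
qed

section \<open>Deletion rounds, parent maps and the hyperedges they define\<close>

lemma fst_delete_round:
    "fst (delete_round r X Z) = fst Z \<union> {e \<in> (\<lambda>e. e - X) ` snd Z. card e = r}"
  and snd_delete_round:
    "snd (delete_round r X Z) = {e \<in> (\<lambda>e. e - X) ` snd Z. card e = r + 1}"
  by (simp_all add: delete_round_def case_prod_unfold Let_def)

lemma mono_on_insert_Union: "mono_on A (\<lambda>K. insert n (\<Union>K))"
  by (intro monotone_onI) auto

locale rooted_matching =
  fixes r :: nat and M :: "'a set set" and n :: 'a
  assumes r_pos: "r \<ge> 1"
    and finite_M: "finite M"
    and disj: "disjoint M"
    and card_block: "\<And>B. B \<in> M \<Longrightarrow> card B = r"
    and root: "n \<notin> \<Union>M"
begin

abbreviation parent_maps :: "('a set \<Rightarrow> 'a) set" where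
  "parent_maps \<equiv> admissible (\<lambda>K. insert n (\<Union>K)) M"

definition hyperedges :: "('a set \<Rightarrow> 'a) \<Rightarrow> 'a set set" where
  "hyperedges p = (\<lambda>B. insert (p B) B) ` M"

lemma block_unique: "x \<in> A \<Longrightarrow> x \<in> B \<Longrightarrow> A \<in> M \<Longrightarrow> B \<in> M \<Longrightarrow> A = B"
  using disj by (auto simp: disjoint_def)

lemma finite_block: "B \<in> M \<Longrightarrow> finite B"
  using card_block[of B] r_pos by (intro card_ge_0_finite) simp

lemma block_ne: "B \<in> M \<Longrightarrow> B \<noteq> {}"
  using card_block[of B] r_pos by auto

lemma finite_verts: "finite (insert n (\<Union>M))"
  using finite_M finite_block by auto

text \<open>The working form of admissibility: blocks are disjoint and do not contain
  \<open>n\<close>, so a parent in \<open>insert n (\<Union>(M - S))\<close> lies outside every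
  block of \<open>S\<close>.\<close>

lemma parent_maps_step:
  assumes "p \<in> parent_maps" "S \<subseteq> M" "S \<noteq> {}"
  obtains B where "B \<in> S" "p B \<in> insert n (\<Union>M)" "p B \<notin> \<Union>S"
proof -
  obtain B where B: "B \<in> S" "p B \<in> insert n (\<Union>(M - S))"
    using admissibleD(2)[OF assms] by blast
  have "p B \<notin> \<Union>S"
    using B(2) assms(2) root block_unique by blast
  with B that show thesis by blast
qed

lemma parent_notin:
  assumes "p \<in> parent_maps" "B \<in> M"
  shows "p B \<notin> B" "p B \<in> insert n (\<Union>M)"
  using parent_maps_step[OF assms(1), of "{B}"] assms(2) by auto

lemma card_hyperedge:
  assumes "p \<in> parent_maps" "B \<in> M"
  shows "card (insert (p B) B) = r + 1"
  using parent_notin[OF assms] assms(2) card_block finite_block by simp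

text \<open>The block \<open>B\<close> is nonempty and disjoint from \<open>A\<close>, so an element
  of \<open>B\<close> found in \<open>insert x A\<close> must be \<open>x\<close>.\<close>

lemma insert_eq_insert_block:
  assumes "insert x A = insert y B" "A \<in> M" "B \<in> M" "A \<noteq> B"
  shows "x \<in> B"
proof -
  obtain z where "z \<in> B" using block_ne assms(3) by blast
  moreover from this have "z \<notin> A" using block_unique[of z A B] assms(2-4) by blast
  moreover have "z \<in> insert x A" using assms(1) \<open>z \<in> B\<close> by simp
  ultimately show ?thesis by simp
qed

text \<open>Two blocks with the same hyperedge would contain each other's parents, contradicting
  admissibility for the pair.\<close>

lemma inj_on_hyperedge:
  assumes "p \<in> parent_maps"
  shows "inj_on (\<lambda>B. insert (p B) B) M"
proof (rule inj_onI, rule ccontr)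
  fix A B assume AB: "A \<in> M" "B \<in> M" "insert (p A) A = insert (p B) B" "A \<noteq> B"
  have "p A \<in> B" "p B \<in> A"
    by (rule insert_eq_insert_block[OF AB(3,1,2,4)])
      (rule insert_eq_insert_block[OF AB(3)[symmetric] AB(2,1) AB(4)[symmetric]])
  moreover have "{A, B} \<subseteq> M" using AB(1,2) by simp
  then obtain C where "C \<in> {A, B}" "p C \<notin> \<Union>{A, B}"
    by (rule parent_maps_step[OF assms _ insert_not_empty])
  ultimately show False by blast
qed

text \<open>Let \<open>S\<close> be the set of blocks where \<open>p\<close> and \<open>q\<close>
  differ, and pick \<open>B\<close> in \<open>S\<close> whose parent under \<open>p\<close> lies
  outside \<open>\<Union>S\<close>. Its hyperedge must come from another block \<open>C\<close>
  under \<open>q\<close>. Then \<open>p B\<close> lies in \<open>C\<close>, and \<open>C\<close> is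
  in \<open>S\<close> because \<open>p\<close> gives different blocks different hyperedges: a
  contradiction.\<close>

lemma inj_on_hyperedges: "inj_on hyperedges parent_maps"
proof (rule inj_onI, rule ccontr)
  fix p q assume p: "p \<in> parent_maps" and q: "q \<in> parent_maps"
    and eq: "hyperedges p = hyperedges q" and "p \<noteq> q"
  define S where "S = {B \<in> M. p B \<noteq> q B}"
  have "S \<noteq> {}"
    using \<open>p \<noteq> q\<close> extensionalityI[OF admissibleD(1)[OF p] admissibleD(1)[OF q]]
    unfolding S_def by blast
  then obtain B where B: "B \<in> S" "p B \<notin> \<Union>S"
    using parent_maps_step[OF p, of S] unfolding S_def by blast
  have "insert (p B) B \<in> hyperedges q"
    using B(1) unfolding eq[symmetric] by (auto simp: hyperedges_def S_def)
  then obtain C where C: "C \<in> M" "insert (p B) B = insert (q C) C"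
    by (auto simp: hyperedges_def)
  have "C \<noteq> B"
    using C B(1) parent_notin[OF p, of B] unfolding S_def by auto
  moreover have "C \<in> S"
  proof (rule ccontr)
    assume "C \<notin> S"
    then have "insert (p B) B = insert (p C) C" using C by (simp add: S_def)
    then show False
      using inj_onD[OF inj_on_hyperedge[OF p], of B C] B(1) C(1) \<open>C \<noteq> B\<close> by (simp add: S_def)
  qed
  moreover have "p B \<in> C"
    using insert_eq_insert_block[OF C(2) _ C(1)] B(1) \<open>C \<noteq> B\<close> by (auto simp: S_def)
  ultimately show False using B(2) by blast
qed

section \<open>The hyperedges of a parent map form a spanning tree\<close>

lemma connected_hyperedges:
  assumes "p \<in> parent_maps"
  shows "Digraph_Component.connected (with_proj (incidence_graph (insert n (\<Union>M)) (hyperedges p)))"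
proof -
  let ?V = "insert n (\<Union>M)"
  let ?G = "incidence_graph ?V (hyperedges p)"
  interpret G: pair_graph ?G
    using finite_verts finite_M by (intro pair_graph_incidence_graph) (auto simp: hyperedges_def)
  define R where "R = {x. Inl n \<rightarrow>\<^sup>*\<^bsub>with_proj ?G\<^esub> x}"
  have step: "y \<in> R" if "x \<in> R" "(x, y) \<in> parcs ?G" for x y
    using that G.reachable_adj_trans[of "Inl n" x y] by (simp add: R_def)
  have n: "Inl n \<in> R" by (auto simp: R_def intro!: G.reachable_refl)
  have edge: "Inr (insert (p B) B) \<in> R \<longleftrightarrow> Inl x \<in> R" if "B \<in> M" "x \<in> insert (p B) B" for B x
  proof -
    have "(Inr (insert (p B) B), Inl x) \<in> parcs ?G" "(Inl x, Inr (insert (p B) B)) \<in> parcs ?G"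
      using that parent_notin(2)[OF assms that(1)]
      by (auto simp: parcs_incidence_graph_iff hyperedges_def)
    then show ?thesis using step by blast
  qed
  \<comment> \<open>These are the blocks whose hyperedge is not reached from \<open>n\<close>. If
    there were any, admissibility would give one whose parent is \<open>n\<close> or lies in a
    reached block, and its hyperedge would be reached after all.\<close>
  define S where "S = {B \<in> M. Inr (insert (p B) B) \<notin> R}"
  have "S = {}"
  proof (rule ccontr)
    assume "S \<noteq> {}"
    then obtain B where B: "B \<in> S" "p B \<in> ?V" "p B \<notin> \<Union>S"
      using parent_maps_step[OF assms, of S] unfolding S_def by blast
    have "Inl (p B) \<in> R"
    proof (cases "p B = n")
      case False
      then obtain C where "C \<in> M" "p B \<in> C" using B(2) by blast
      moreover have "C \<notin> S" using B(3) \<open>p B \<in> C\<close> by blast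
      ultimately show ?thesis using edge[of C "p B"] by (simp add: S_def)
    qed (simp add: n)
    then show False using edge[of B "p B"] B(1) by (simp add: S_def)
  qed
  then have edges: "Inr (insert (p B) B) \<in> R" if "B \<in> M" for B
    using that unfolding S_def by blast
  have "y \<in> R" if y: "y \<in> pverts ?G" for y
  proof (cases y)
    case (Inl v)
    show ?thesis
    proof (cases "v = n")
      case False
      then obtain B where "B \<in> M" "v \<in> B" using y Inl by (auto elim!: PlusE)
      then show ?thesis using Inl edge[of B v] edges by simp
    qed (use Inl n in simp)
  next
    case (Inr e)
    then have "e \<in> hyperedges p" using y by (auto elim!: PlusE)
    then show ?thesis using Inr edges by (auto simp: hyperedges_def)
  qed
  then show ?thesis
    by (intro G.connectedI_root[of "Inl n"]) (auto simp: R_def)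
qed

lemma hyper_spanning_tree_hyperedges:
  assumes "p \<in> parent_maps"
  shows "hyper_spanning_tree (r + 1) (insert n (\<Union>M)) (hyperedges p)"
proof -
  let ?V = "insert n (\<Union>M)"
  let ?G = "incidence_graph ?V (hyperedges p)"
  interpret G: pair_graph ?G
    using finite_verts finite_M by (intro pair_graph_incidence_graph) (auto simp: hyperedges_def)
  have "\<not> (G.cycle q \<and> 3 \<le> length q)" for q
  proof
    assume q: "G.cycle q \<and> 3 \<le> length q"
    define C where C_def: "C = snd ` set q"
    note cyc = cycle_incidence_graph[OF G.pair_graph conjunct1[OF q] conjunct2[OF q] C_def]
    define S where "S = {B \<in> M. Inr (insert (p B) B) \<in> C}"
    \<comment> \<open>Every block on the cycle has a child block on the cycle; since a block has only one parent
      block, choosing children permutes S, so no block of S has its parent outside S.\<close>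
    have child: "\<exists>A\<in>S. p A \<in> B" if B: "B \<in> S" for B
    proof -
      have "B \<in> M" "Inr (insert (p B) B) \<in> C" using B by (auto simp: S_def)
      \<comment> \<open>The cycle passes through two different vertices of the hyperedge; at least
        one of them is not \<open>p B\<close> and hence lies in \<open>B\<close>.\<close>
      then obtain v where v: "Inl v \<in> C" "v \<in> B"
        using cyc(1)[of "insert (p B) B"] by blast
      then obtain e where e: "Inr e \<in> C" "e \<noteq> insert (p B) B" "e \<in> hyperedges p" "v \<in> e"
        using cyc(2)[of v] by metis
      then obtain A where A: "A \<in> M" "e = insert (p A) A" by (auto simp: hyperedges_def)
      then have "A \<noteq> B" using e by blast
      then have "v \<notin> A" using v(2) A(1) \<open>B \<in> M\<close> block_unique by blast
      then have "p A \<in> B" using e(4) A(2) v(2) by auto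
      then show ?thesis using A e(1) by (auto simp: S_def)
    qed
    then obtain c where c: "\<And>B. B \<in> S \<Longrightarrow> c B \<in> S \<and> p (c B) \<in> B" by metis
    have "S \<subseteq> M" by (auto simp: S_def)
    have "inj_on c S"
    proof (rule inj_onI)
      fix A B assume "A \<in> S" "B \<in> S" "c A = c B"
      then show "A = B"
        using c[of A] c[of B] block_unique[of "p (c A)" A B] \<open>S \<subseteq> M\<close> by auto
    qed
    moreover have "finite S" using \<open>S \<subseteq> M\<close> finite_M finite_subset by blast
    ultimately have surj: "c ` S = S" using c by (intro endo_inj_surj) auto
    have "S \<noteq> {}"
    proof -
      have "q \<noteq> []" using q by auto
      then obtain x where x: "x \<in> C" by (cases q) (auto simp: C_def)
      then obtain v where "Inl v \<in> C" using cyc(1) by (cases x) metis+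
      then obtain e where "Inr e \<in> C" "e \<in> hyperedges p" using cyc(2) by blast
      then show ?thesis by (auto simp: S_def hyperedges_def)
    qed
    then obtain B where B: "B \<in> S" "p B \<notin> \<Union>S"
      using parent_maps_step[OF assms \<open>S \<subseteq> M\<close>] by blast
    then obtain A where "A \<in> S" "B = c A" using surj by blast
    then show False using c[of A] B(2) by blast
  qed
  moreover have "e \<subseteq> ?V \<and> card e = r + 1" if "e \<in> hyperedges p" for e
    using that parent_notin(2)[OF assms] card_hyperedge[OF assms] by (auto simp: hyperedges_def)
  ultimately show ?thesis
    using connected_hyperedges[OF assms] G.pair_graph
    unfolding hyper_spanning_tree_def undirected_tree_def by blast
qed

section \<open>Recovering the matching from the tree and the parent map from the matching\<close>

lemma delete_round_hyperedges:
  assumes p: "p \<in> parent_maps" and "A \<subseteq> M" and X: "\<And>B. B \<in> A \<Longrightarrow> B \<inter> X = {}"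
  shows "delete_round r X (B0, (\<lambda>B. insert (p B) B) ` A) =
     (B0 \<union> {B \<in> A. p B \<in> X}, (\<lambda>B. insert (p B) B) ` {B \<in> A. p B \<notin> X})"
proof -
  \<comment> \<open>The blocks in \<open>A\<close> avoid \<open>X\<close>, so only the parent can be
    deleted. Every hyperedge therefore ends with size \<open>r\<close> or \<open>r + 1\<close>, and
    none is lost.\<close>
  have del: "insert (p B) B - X = (if p B \<in> X then B else insert (p B) B)" if "B \<in> A" for B
    using X[OF that] by auto
  have card: "card (insert (p B) B) = r + 1" "card B = r" if "B \<in> A" for B
    using that assms(2) card_hyperedge[OF p] card_block by auto
  have img: "(\<lambda>e. e - X) ` (\<lambda>B. insert (p B) B) ` A =
      {B \<in> A. p B \<in> X} \<union> (\<lambda>B. insert (p B) B) ` {B \<in> A. p B \<notin> X}"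
    unfolding image_image using del by (auto simp: image_iff split: if_splits)
  have sep: "{e \<in> U \<union> W. card e = r} = U" "{e \<in> U \<union> W. card e = r + 1} = W"
    if "\<forall>e\<in>U. card e = r" "\<forall>e\<in>W. card e = r + 1" for U W :: "'a set set"
    using that by auto
  have "\<forall>e\<in>{B \<in> A. p B \<in> X}. card e = r"
    "\<forall>e\<in>(\<lambda>B. insert (p B) B) ` {B \<in> A. p B \<notin> X}. card e = r + 1"
    using card by blast+
  then show ?thesis
    unfolding delete_round_def Let_def prod.case img by (simp only: sep)
qed

text \<open>After each round the remaining hyperedges are exactly those of the blocks not yet found.
  If some blocks were never found, admissibility would give one of them with parent \<open>n\<close>
  or with parent in a found block, and a round would find it.\<close>

lemma arising_matching_hyperedges:
  assumes p: "p \<in> parent_maps"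
  shows "arising_matching r n (hyperedges p) = M"
proof -
  let ?s = "matching_state r n (hyperedges p)"
  have inv: "fst (?s j) \<subseteq> M \<and> ?s j = (fst (?s j), (\<lambda>B. insert (p B) B) ` (M - fst (?s j)))" for j
  proof (induction j)
    case 0
    have "delete_round r {n} ({}, (\<lambda>B. insert (p B) B) ` M) =
      ({} \<union> {B \<in> M. p B \<in> {n}}, (\<lambda>B. insert (p B) B) ` {B \<in> M. p B \<notin> {n}})"
      using root by (intro delete_round_hyperedges[OF p]) auto
    moreover have "{B \<in> M. p B \<notin> {n}} = M - {B \<in> M. p B \<in> {n}}" by auto
    ultimately show ?case by (simp add: hyperedges_def)
  next
    case (Suc j)
    let ?D = "fst (?s j)"
    let ?D' = "?D \<union> {B \<in> M - ?D. p B \<in> \<Union>?D}"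
    have "?s (Suc j) = delete_round r (\<Union>?D) (?s j)"
      by (simp only: matching_state.simps Let_def)
    also have "\<dots> = delete_round r (\<Union>?D) (?D, (\<lambda>B. insert (p B) B) ` (M - ?D))"
      by (rule arg_cong[OF conjunct2[OF Suc]])
    also have "\<dots> = (?D', (\<lambda>B. insert (p B) B) ` {B \<in> M - ?D. p B \<notin> \<Union>?D})"
      using conjunct1[OF Suc] block_unique by (intro delete_round_hyperedges[OF p]) blast+
    also have "{B \<in> M - ?D. p B \<notin> \<Union>?D} = M - ?D'"
      by blast
    finally show ?case
      using conjunct1[OF Suc] by (simp only: fst_conv) blast
  qed
  have zero: "B \<in> fst (?s 0)" if "B \<in> M" "p B = n" for B
  proof -
    have "insert n B - {n} = B" using that(1) root by auto
    then show ?thesis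
      using that card_block by (force simp: fst_delete_round hyperedges_def image_iff)
  qed
  \<comment> \<open>A block whose parent is covered after round \<open>j\<close> is found by round
    \<open>j + 1\<close> at the latest.\<close>
  have suc: "B \<in> fst (?s (Suc j))" if "B \<in> M" "C \<in> fst (?s j)" "p B \<in> C" for B C j
  proof (cases "B \<in> fst (?s j)")
    case True
    then show ?thesis by (simp add: Let_def fst_delete_round)
  next
    case False
    have "B - \<Union>(fst (?s j)) = B"
      using that(1) False inv[of j] block_unique by blast
    then have "insert (p B) B - \<Union>(fst (?s j)) = B"
      using that(2,3) by (simp add: insert_Diff_if) blast
    moreover have "snd (?s j) = (\<lambda>B. insert (p B) B) ` (M - fst (?s j))"
      using inv[of j] by (metis snd_conv)
    then have "insert (p B) B \<in> snd (?s j)"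
      using False that(1) by blast
    ultimately have "B \<in> (\<lambda>e. e - \<Union>(fst (?s j))) ` snd (?s j)"
      by (intro image_eqI[of _ _ "insert (p B) B"]) simp_all
    then show ?thesis
      using card_block[OF that(1)] by (simp add: Let_def fst_delete_round)
  qed
  let ?D = "\<Union>j. fst (?s j)"
  have "M - ?D = {}"
  proof (rule ccontr)
    assume "M - ?D \<noteq> {}"
    then obtain B where B: "B \<in> M - ?D" "p B \<in> insert n (\<Union>M)" "p B \<notin> \<Union>(M - ?D)"
      using parent_maps_step[OF p, of "M - ?D"] by blast
    show False
    proof (cases "p B = n")
      case True
      then show False using B(1) zero[of B] by (simp del: matching_state.simps)
    next
      case False
      then obtain C where C: "C \<in> M" "p B \<in> C" using B(2) by blast
      then have "C \<in> ?D" using B(3) by (simp del: matching_state.simps) blast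
      then obtain j where "C \<in> fst (?s j)" ..
      then have "B \<in> fst (?s (Suc j))" using suc[of B C j] C(2) B(1) by blast
      then show False using B(1) by blast
    qed
  qed
  then show ?thesis
    unfolding arising_matching_def using conjunct1[OF inv] by (auto simp del: matching_state.simps)
qed

text \<open>The vertex \<open>x\<close> is the one whose deletion turned a hyperedge into
  \<open>B\<close>. It was deleted in the first round that produced \<open>B\<close>, so it is
  \<open>n\<close> or belongs to a block found strictly earlier; the first round of appearance thus
  serves as a rank.\<close>

lemma matching_state_parent:
  assumes T: "\<And>e. e \<in> T \<Longrightarrow> card e = r + 1" and "B \<in> arising_matching r n T"
  obtains x where "insert x B \<in> T" "x \<notin> B"
    "x = n \<or> (\<exists>A \<in> arising_matching r n T. x \<in> A \<and>
       (LEAST j. A \<in> fst (matching_state r n T j)) < (LEAST j. B \<in> fst (matching_state r n T j)))"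
proof -
  let ?s = "matching_state r n T"
  let ?rk = "\<lambda>B. LEAST j. B \<in> fst (?s j)"
  \<comment> \<open>A hyperedge that remains has size \<open>r + 1\<close> before and after the
    deletion, so it was not changed at all.\<close>
  have sub: "snd (?s j) \<subseteq> T" for j
  proof -
    have keep: "snd (delete_round r X Z) \<subseteq> T" if "snd Z \<subseteq> T" for X Z
    proof
      fix h assume "h \<in> snd (delete_round r X Z)"
      then obtain e where e: "e \<in> snd Z" "h = e - X" "card (e - X) = r + 1"
        by (auto simp: snd_delete_round)
      moreover have "e \<in> T" using e(1) that by blast
      moreover have "finite e" using T[OF \<open>e \<in> T\<close>] card.infinite by fastforce
      ultimately have "e - X = e"
        using T by (intro card_subset_eq) auto
      then show "h \<in> T" using e \<open>e \<in> T\<close> by simp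
    qed
    show ?thesis
      by (induction j) (simp_all add: Let_def keep)
  qed
  \<comment> \<open>The size drops from \<open>r + 1\<close> to \<open>r\<close>, so exactly one
    vertex was deleted.\<close>
  have insert_block: "\<exists>x\<in>X. insert x B \<in> T \<and> x \<notin> B"
    if "e \<in> T" "B = e - X" "card B = r" for e X
  proof -
    have "card e = r + 1" using T that(1) .
    moreover from this have "finite e" by (intro card_ge_0_finite) simp
    ultimately have "card (e \<inter> X) = 1"
      using card_Int_Diff[of e X] that(2,3) by simp
    then obtain x where "e \<inter> X = {x}" by (rule card_1_singletonE)
    then have "x \<in> X" "e = insert x B" "x \<notin> B" using that(2) by blast+
    then show ?thesis using that(1) by blast
  qed
  obtain i where "B \<in> fst (?s i)" using assms(2) unfolding arising_matching_def by blast
  then have rk: "B \<in> fst (?s (?rk B))" by (rule LeastI[of "\<lambda>j. B \<in> fst (?s j)"])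
  show thesis
  proof (cases "?rk B")
    case 0
    with rk have "B \<in> fst (?s 0)" by simp
    then obtain e where "e \<in> T" "B = e - {n}" "card B = r"
      by (auto simp: fst_delete_round)
    then show thesis using insert_block[of e "{n}"] that by blast
  next
    case (Suc j)
    then have "B \<notin> fst (?s j)" using not_less_Least[of j "\<lambda>j. B \<in> fst (?s j)"] by simp
    with rk Suc obtain e where "e \<in> snd (?s j)" "B = e - \<Union>(fst (?s j))" "card B = r"
      by (auto simp: fst_delete_round Let_def)
    then obtain x where x: "x \<in> \<Union>(fst (?s j))" "insert x B \<in> T" "x \<notin> B"
      using insert_block[of e] sub[of j] by blast
    then obtain A where A: "A \<in> fst (?s j)" "x \<in> A" by blast
    then have "?rk A < ?rk B" using Suc Least_le[of "\<lambda>j. A \<in> fst (?s j)" j] by simp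
    moreover have "A \<in> arising_matching r n T" using A(1) by (auto simp: arising_matching_def)
    ultimately show thesis using that x A(2) by blast
  qed
qed

text \<open>The vertices removed by the procedure define a parent map. Its hyperedges lie in
  \<open>T\<close> and already connect all vertices, so minimality of trees leaves no further
  hyperedge in \<open>T\<close>.\<close>

lemma hyper_spanning_tree_parent_map:
  assumes T: "hyper_spanning_tree (r + 1) (insert n (\<Union>M)) T" and M: "arising_matching r n T = M"
  shows "T \<in> hyperedges ` parent_maps"
proof -
  let ?s = "matching_state r n T"
  let ?rk = "\<lambda>B. LEAST j. B \<in> fst (?s j)"
  have edge: "e \<subseteq> insert n (\<Union>M) \<and> card e = r + 1" if "e \<in> T" for e
    using T that by (simp add: hyper_spanning_tree_def)
  have "\<forall>B\<in>M. \<exists>x. insert x B \<in> T \<and> x \<notin> B \<and> (x = n \<or> (\<exists>A\<in>M. x \<in> A \<and> ?rk A < ?rk B))"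
    using matching_state_parent[of T] edge M by metis
  then obtain p' where p': "\<And>B. B \<in> M \<Longrightarrow> insert (p' B) B \<in> T \<and> p' B \<notin> B \<and>
      (p' B = n \<or> (\<exists>A\<in>M. p' B \<in> A \<and> ?rk A < ?rk B))"
    by metis
  define p where "p = restrict p' M"
  have p: "p \<in> parent_maps"
  proof (rule admissibleI[OF mono_on_insert_Union])
    fix S assume S: "S \<subseteq> M" "S \<noteq> {}"
    then obtain A where "A \<in> S" by blast
    \<comment> \<open>A block of least rank in \<open>S\<close> works: its parent is
      \<open>n\<close> or lies in a block of smaller rank, which cannot belong to
      \<open>S\<close>.\<close>
    then obtain B where B: "B \<in> S" "\<And>A. A \<in> S \<Longrightarrow> ?rk B \<le> ?rk A"
      using ex_has_least_nat[of "\<lambda>A. A \<in> S" A ?rk] by blast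
    then have "B \<in> M" using S by blast
    have "p' B \<in> insert n (\<Union>(M - S))"
      using p'[OF \<open>B \<in> M\<close>] B(2) by (meson DiffI UnionI insertCI insertI1 not_le)
    then show "\<exists>B\<in>S. p B \<in> insert n (\<Union>(M - S))"
      using B(1) \<open>B \<in> M\<close> by (auto simp: p_def)
  qed (simp add: p_def)
  have "hyperedges p \<subseteq> T"
    using p' by (auto simp: hyperedges_def p_def)
  moreover have "T \<subseteq> hyperedges p"
  proof
    fix e assume "e \<in> T"
    then have "e \<subseteq> insert n (\<Union>M)" "2 \<le> card e"
      using edge r_pos by simp_all
    moreover have "undirected_tree (incidence_graph (insert n (\<Union>M)) T)"
      using T by (simp add: hyper_spanning_tree_def)
    ultimately show "e \<in> hyperedges p"
      using undirected_tree_minimal connected_hyperedges[OF p] \<open>hyperedges p \<subseteq> T\<close> \<open>e \<in> T\<close> by metis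
  qed
  ultimately show ?thesis using p by blast
qed

section \<open>Assembling the bijection and comparing cardinalities\<close>

lemma bij_betw_hyperedges:
  "bij_betw hyperedges parent_maps
     {T. hyper_spanning_tree (r + 1) (insert n (\<Union>M)) T \<and> arising_matching r n T = M}"
  unfolding bij_betw_def
proof
  show "inj_on hyperedges parent_maps" by (rule inj_on_hyperedges)
  show "hyperedges ` parent_maps =
    {T. hyper_spanning_tree (r + 1) (insert n (\<Union>M)) T \<and> arising_matching r n T = M}"
    using hyper_spanning_tree_hyperedges arising_matching_hyperedges
      hyper_spanning_tree_parent_map by blast
qed

text \<open>This is also the size of \<open>{..r * card K}\<close>, which makes the counts of parent
  maps and parking functions agree.\<close>

lemma card_insert_root_Union:
  assumes "K \<subseteq> M"
  shows "card (insert n (\<Union>K)) = Suc (r * card K)"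
proof -
  have "card (\<Union>K) = (\<Sum>B\<in>K. card B)"
    using assms disj finite_block by (intro card_Union_disjoint) (auto intro: pairwise_subset simp: disjoint_def)
  also have "\<dots> = r * card K" using assms card_block by (simp add: subset_iff)
  finally have "card (\<Union>K) = r * card K" .
  moreover have "\<Union>K \<subseteq> \<Union>M" using assms by (rule Union_mono)
  then have "n \<notin> \<Union>K" "finite (\<Union>K)"
    using root finite_verts finite_subset[of "\<Union>K" "\<Union>M"] by (blast, simp)
  ultimately show ?thesis by simp
qed

end

theorem theorem3:
  fixes r k n :: nat and M :: "nat set set"
  assumes "r \<ge> 1" and "k \<ge> 1" and "n = r * k + 1"
    and "perfect_matching r {1..r * k} M"
  shows "(\<exists>f. bij_betw f
             {T. hyper_spanning_tree (r + 1) {1..n} T \<and> arising_matching r n T = M}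
             (parking_functions r k))
       \<and> card {T. hyper_spanning_tree (r + 1) {1..n} T \<and> arising_matching r n T = M}
         = card (parking_functions r k)"
proof -
  let ?T = "{T. hyper_spanning_tree (r + 1) {1..n} T \<and> arising_matching r n T = M}"
  have part: "partition_on {1..r * k} M" and card: "\<And>B. B \<in> M \<Longrightarrow> card B = r"
    using assms(4) by (auto simp: perfect_matching_def)
  have Un: "\<Union>M = {1..r * k}" using partition_onD1[OF part] by simp
  interpret rooted_matching r M n
    using assms(1,3) part card Un
    by unfold_locales (auto simp: partition_onD2 intro: finite_elements)
  \<comment> \<open>Counting the vertices in two ways determines the number of blocks, since
    \<open>r\<close> is positive.\<close>
  have "Suc (r * card M) = card (insert n (\<Union>M))"
    by (simp add: card_insert_root_Union)
  then have k: "card M = k"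
    using assms(1,3) Un by simp
  have V: "insert n (\<Union>M) = {1..n}"
    using assms(3) Un by auto
  have fin: "finite parent_maps"
    using finite_M finite_verts by (rule finite_admissible)
  have bij: "bij_betw hyperedges parent_maps ?T"
    using bij_betw_hyperedges unfolding V .
  have "card ?T = card parent_maps"
    using bij_betw_same_card[OF bij] by simp
  also have "\<dots> = card (admissible (\<lambda>K. {..r * card K}) M)"
  proof (rule card_admissible_cong)
    show "mono_on (Pow M) (\<lambda>K. {..r * card K})"
      using finite_M finite_subset by (intro monotone_onI) (auto intro!: mult_le_mono2 card_mono)
  qed (use finite_M finite_verts mono_on_insert_Union card_insert_root_Union in auto)
  also have "\<dots> = card (parking_functions r k)"
    using card_parking_functions(2)[OF finite_M] k by simp
  finally have eq: "card ?T = card (parking_functions r k)" .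
  \<comment> \<open>Finiteness matters because \<open>card\<close> is 0 on infinite sets. For finite
    sets, equal cardinality yields a bijection.\<close>
  moreover have "finite ?T" using bij fin bij_betw_finite by blast
  moreover have "finite (parking_functions r k)"
    using card_parking_functions(1)[OF finite_M] k by simp
  ultimately show ?thesis
    using finite_same_card_bij by blast
qed

end
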